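(* Let $\gamma\in\mathbb{R}$ and let $r$ be an asymptotic revenue profile as in the context. Consider the problem of maximizing $R(f)$ over all (measurable) $f$ subject to $0\le f(x)\le1$ for $x\in[0,\infty)$ and $\int_0^\infty f(x)e^{-\gamma x}\,dx<\infty$ ($f$ is not required to be monotone). If $r$ is nonincreasing for $x\ge0$, then there exist optimal asymptotic admission controls that solve this maximization problem. Moreover, the optimal asymptotic admission control profiles have a threshold structure of the form $$f(x)=\mathbf{1}[0\le x<\eta^{\mathrm{opt}}],$$ where $\eta^{\mathrm{opt}}$ is any solution $\eta$ of $$r(\eta)=R_{\mathrm T}(\eta)$$ if $r(0)>R_{\mathrm T}(0)$, and $\eta^{\mathrm{opt}}=0$ if $r(0)\le R_{\mathrm T}(0)$. If $r$ is strictly decreasing in $x\ge0$, then $\eta^{\mathrm{opt}}$ is unique.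
   Context: $\phi,\Phi$ are the standard normal density and distribution function. The asymptotic revenue profile $r:\mathbb{R}\to\mathbb{R}$ is a piecewise bounded, twice differentiable continuous function with bounded derivatives. For an asymptotic admission control profile $f$ on $[0,\infty)$ with $0\le f\le1$ and $\int_0^\infty f(x)e^{-\gamma x}\,dx<\infty$, $$R(f)=\frac{\int_{-\infty}^0 r(x)e^{-\frac12x^2-\gamma x}\,dx+\int_0^\infty r(x)f(x)e^{-\gamma x}\,dx}{\frac{\Phi(\gamma)}{\phi(\gamma)}+\int_0^\infty f(x)e^{-\gamma x}\,dx},$$ and for $\eta\ge0$, $R_{\mathrm T}(\eta)=R(\mathbf{1}[0\le x<\eta])$, that is, $$R_{\mathrm T}(\eta)=\frac{\int_{-\infty}^0 r(x)e^{-\frac12x^2-\gamma x}\,dx+\int_0^\eta r(x)e^{-\gamma x}\,dx}{\frac{\Phi(\gamma)}{\phi(\gamma)}+\int_0^\eta e^{-\gamma x}\,dx}.$$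
   Formalization: Existence as printed fails (γ=0, r=min(x,0)): an optimal control is asserted only if γ>0 or r(x)≤R_T(x) for some x≥0, and a threshold η^opt only under the latter; optimal profiles are shown to be thresholds (almost everywhere) only for strictly decreasing r when η^opt exists. *)

theory Defs
  imports "HOL-Probability.Probability"
begin

text \<open>
  The exceptional set \<open>P\<close> of breakpoints is locally finite, so that \<open>r\<close> is twice differentiable on
  each of the open pieces between consecutive breakpoints. The first two derivatives are globally
  bounded off \<open>P\<close>. The function \<open>r\<close> itself may be unbounded (for instance linear); boundedness on
  bounded pieces follows from continuity.
\<close>

definition revenue_profile :: "(real \<Rightarrow> real) \<Rightarrow> bool" where
  "revenue_profile r \<longleftrightarrow>
     continuous_on UNIV r \<and>
     (\<exists>P. (\<forall>a b. finite (P \<inter> {a..b})) \<and>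
          (\<forall>x. x \<notin> P \<longrightarrow> r differentiable (at x) \<and> deriv r differentiable (at x)) \<and>
          bounded (deriv r ` (- P)) \<and> bounded (deriv (deriv r) ` (- P)))"

text \<open>Only the values of \<open>f\<close> on the half-line \<open>[0,\<infinity>)\<close> matter.\<close>

definition admissible_control :: "real \<Rightarrow> (real \<Rightarrow> real) \<Rightarrow> bool" where
  "admissible_control \<gamma> f \<longleftrightarrow>
     f \<in> borel_measurable (lebesgue_on {0..}) \<and>
     (\<forall>x\<ge>0. 0 \<le> f x \<and> f x \<le> 1) \<and>
     integrable (lebesgue_on {0..}) (\<lambda>x. f x * exp (- \<gamma> * x))"

text \<open>
  Since \<open>r\<close> may be unbounded below, the integral of \<open>r x * f x * exp (- \<gamma> * x)\<close> can be \<open>-\<infinity>\<close> for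
  an admissible \<open>f\<close>, whereas the Bochner integral of a non-integrable function is \<open>0\<close>.
  The positive part is integrable whenever \<open>r\<close> is bounded above on \<open>[0,\<infinity>)\<close>, so that the
  meaningless case \<open>\<infinity> - \<infinity>\<close> does not occur for nonincreasing \<open>r\<close>.
\<close>

definition extended_integral :: "'a measure \<Rightarrow> ('a \<Rightarrow> real) \<Rightarrow> ereal" where
  "extended_integral M g =
     enn2ereal (\<integral>\<^sup>+ x. ennreal (g x) \<partial>M) - enn2ereal (\<integral>\<^sup>+ x. ennreal (- g x) \<partial>M)"

definition revenue :: "real \<Rightarrow> (real \<Rightarrow> real) \<Rightarrow> (real \<Rightarrow> real) \<Rightarrow> ereal" where
  "revenue \<gamma> r f =
     (ereal (\<integral>x. r x * exp (- (1/2) * x\<^sup>2 - \<gamma> * x) \<partial>lebesgue_on {..0})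
        + extended_integral (lebesgue_on {0..}) (\<lambda>x. r x * f x * exp (- \<gamma> * x)))
     / ereal (cdf std_normal_distribution \<gamma> / std_normal_density \<gamma>
        + (\<integral>x. f x * exp (- \<gamma> * x) \<partial>lebesgue_on {0..}))"

definition optimal_control :: "real \<Rightarrow> (real \<Rightarrow> real) \<Rightarrow> (real \<Rightarrow> real) \<Rightarrow> bool" where
  "optimal_control \<gamma> r f \<longleftrightarrow>
     admissible_control \<gamma> f \<and> (\<forall>g. admissible_control \<gamma> g \<longrightarrow> revenue \<gamma> r g \<le> revenue \<gamma> r f)"

definition threshold_control :: "real \<Rightarrow> real \<Rightarrow> real" where
  "threshold_control \<eta> = indicator {0..<\<eta>}"

definition threshold_revenue :: "real \<Rightarrow> (real \<Rightarrow> real) \<Rightarrow> real \<Rightarrow> ereal" where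
  "threshold_revenue \<gamma> r \<eta> = revenue \<gamma> r (threshold_control \<eta>)"

text \<open>
  In the first case \<open>\<eta>\<close> may be any solution of the equation, and in general there can be several or none.
\<close>

definition optimal_threshold :: "real \<Rightarrow> (real \<Rightarrow> real) \<Rightarrow> real \<Rightarrow> bool" where
  "optimal_threshold \<gamma> r \<eta> \<longleftrightarrow>
     0 \<le> \<eta> \<and>
     (if ereal (r 0) > threshold_revenue \<gamma> r 0
      then ereal (r \<eta>) = threshold_revenue \<gamma> r \<eta>
      else \<eta> = 0)"

lemma extended_integral_eq_integral:
  assumes "integrable M g"
  shows "extended_integral M g = ereal (\<integral>x. g x \<partial>M)"
proof -
  have fin: "(\<integral>\<^sup>+ x. ennreal (g x) \<partial>M) \<noteq> \<infinity>" "(\<integral>\<^sup>+ x. ennreal (- g x) \<partial>M) \<noteq> \<infinity>"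
    using assms by (auto simp: real_integrable_def)
  then obtain a b where ab: "0 \<le> a" "0 \<le> b"
      "(\<integral>\<^sup>+ x. ennreal (g x) \<partial>M) = ennreal a" "(\<integral>\<^sup>+ x. ennreal (- g x) \<partial>M) = ennreal b"
    by (metis ennreal_cases infinity_ennreal_def)
  then show ?thesis
    unfolding extended_integral_def real_lebesgue_integral_def[OF assms]
    by (simp add: enn2ereal_ennreal)
qed

lemma threshold_revenue_eq:
  assumes "continuous_on UNIV r" "0 \<le> \<eta>"
  shows "threshold_revenue \<gamma> r \<eta> = ereal
     (((\<integral>x. r x * exp (- (1/2) * x\<^sup>2 - \<gamma> * x) \<partial>lebesgue_on {..0})
        + (\<integral>x. r x * exp (- \<gamma> * x) \<partial>lebesgue_on {0..\<eta>}))
      / (cdf std_normal_distribution \<gamma> / std_normal_density \<gamma>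
        + (\<integral>x. exp (- \<gamma> * x) \<partial>lebesgue_on {0..\<eta>})))"
proof -
  have key: "integrable (lebesgue_on {0..}) (\<lambda>x. h x * indicator {0..<\<eta>} x)
      \<and> (\<integral>x. h x * indicator {0..<\<eta>} x \<partial>lebesgue_on {0..}) = (\<integral>x. h x \<partial>lebesgue_on {0..\<eta>})"
    if h: "continuous_on UNIV h" for h :: "real \<Rightarrow> real"
  proof -
    have "integrable (lebesgue_on {0..\<eta>}) h"
      using h continuous_on_subset continuous_imp_integrable_real by blast
    then have i: "integrable lebesgue (\<lambda>x. indicator {0..\<eta>} x *\<^sub>R h x)"
      by (simp add: integrable_restrict_space)
    have ae: "AE x in lebesgue. indicator {0..\<eta>} x *\<^sub>R h x
        = indicator {0..} x *\<^sub>R (h x * indicator {0..<\<eta>} x)"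
    proof -
      have "AE x in lebesgue. x \<noteq> \<eta>"
        by (intro AE_completion AE_lborel_singleton)
      then show ?thesis
        by eventually_elim (auto simp: indicator_def)
    qed
    have hm: "h \<in> borel_measurable lebesgue"
      using h by (intro measurable_completion) (simp add: borel_measurable_continuous_onI)
    have m: "(\<lambda>x. indicator {0..} x *\<^sub>R (h x * indicator {0..<\<eta>} x)) \<in> borel_measurable lebesgue"
      using hm by (intro borel_measurable_scaleR borel_measurable_times borel_measurable_indicator) auto
    have "integrable lebesgue (\<lambda>x. indicator {0..} x *\<^sub>R (h x * indicator {0..<\<eta>} x))"
      by (rule integrable_cong_AE_imp[OF i m]) (use ae in eventually_elim, simp)
    moreover have "(\<integral>x. indicator {0..\<eta>} x *\<^sub>R h x \<partial>lebesgue)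
        = (\<integral>x. indicator {0..} x *\<^sub>R (h x * indicator {0..<\<eta>} x) \<partial>lebesgue)"
      using borel_measurable_integrable[OF i] m ae by (rule integral_cong_AE)
    ultimately show ?thesis
      by (simp add: integrable_restrict_space integral_restrict_space)
  qed
  have c: "continuous_on UNIV (\<lambda>x. exp (- \<gamma> * x))"
    by (intro continuous_intros)
  note k1 = key[OF continuous_on_mult[OF assms(1) c]] and k2 = key[OF c]
  have e1: "(\<lambda>x. r x * indicator {0..<\<eta>} x * exp (- \<gamma> * x))
      = (\<lambda>x. r x * exp (- \<gamma> * x) * indicator {0..<\<eta>} x)"
   and e2: "(\<lambda>x. indicator {0..<\<eta>} x * exp (- \<gamma> * x)) = (\<lambda>x. exp (- \<gamma> * x) * indicator {0..<\<eta>} x)"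
    by (auto simp: fun_eq_iff)
  have "0 < cdf std_normal_distribution \<gamma>"
  proof (rule ccontr)
    interpret prob_space std_normal_distribution
      by (rule prob_space_normal_density) simp
    assume "\<not> 0 < cdf std_normal_distribution \<gamma>"
    then have "emeasure std_normal_distribution {..\<gamma>} = 0"
      by (simp add: cdf_def emeasure_eq_measure not_less measure_le_0_iff)
    then have "(\<integral>\<^sup>+ x. ennreal (std_normal_density x) * indicator {..\<gamma>} x \<partial>lborel) = 0"
      by (simp add: emeasure_density)
    then have "AE x in lborel. ennreal (std_normal_density x) * indicator {..\<gamma>} x = 0"
      by (subst (asm) nn_integral_0_iff_AE) auto
    then have "AE x in lborel. x \<notin> {\<gamma> - 1..\<gamma>}"
    proof eventually_elim
      case (elim x)
      then show ?case
        using normal_density_pos[of 1 0 x] by (auto simp: indicator_def ennreal_eq_0_iff split: if_splits)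
    qed
    then have "emeasure lborel {\<gamma> - 1..\<gamma>} = 0"
      by (subst (asm) AE_iff_measurable[where N = "{\<gamma> - 1..\<gamma>}"]) auto
    then show False
      by simp
  qed
  moreover have "0 \<le> (\<integral>x. exp (- \<gamma> * x) \<partial>lebesgue_on {0..\<eta>})"
    by (intro integral_nonneg_AE) auto
  ultimately have "0 < cdf std_normal_distribution \<gamma> / std_normal_density \<gamma>
        + (\<integral>x. exp (- \<gamma> * x) \<partial>lebesgue_on {0..\<eta>})"
    by (intro add_pos_nonneg divide_pos_pos normal_density_pos) auto
  then show ?thesis
    unfolding threshold_revenue_def revenue_def threshold_control_def e1 e2
    using k1 k2 by (simp add: extended_integral_eq_integral)
qed

end

theory Submission
  imports Defs
begin

text \<open>
  Write \<open>R(f) = N(f) / D(f)\<close>, where both \<open>N\<close> and \<open>D\<close> are affine in \<open>f\<close> and \<open>D\<close> is positive. As in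
  Dinkelbach's method for fractional programs, \<open>R(f) \<le> c\<close> holds exactly when the Lagrangian
  \<open>N(f) - c D(f)\<close> is at most \<open>0\<close>, and for fixed \<open>c\<close> this Lagrangian is a constant plus
  \<open>\<integral> (r x - c) f(x) exp (- \<gamma> x) dx\<close>. It can be maximized pointwise: put \<open>f = 1\<close> where \<open>r > c\<close> and
  \<open>f = 0\<close> where \<open>r < c\<close>. A control \<open>f\<close> of this bang-bang form whose own revenue is \<open>c\<close> is therefore
  optimal (\<open>optimal_controlI\<close>).

  If \<open>r\<close> is nonincreasing, then the threshold control at \<open>\<eta>\<close> is bang-bang at the level \<open>r \<eta>\<close>,
  so each solution of \<open>r \<eta> = R\<^sub>T \<eta>\<close> is optimal; and if \<open>r 0 \<le> R\<^sub>T 0\<close>, then the threshold \<open>0\<close>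
  is bang-bang at the level \<open>R\<^sub>T 0\<close>. A solution exists by the intermediate value theorem as soon as
  \<open>r\<close> does not stay strictly above \<open>R\<^sub>T\<close>.

  If \<open>r\<close> stays strictly above \<open>R\<^sub>T\<close> and \<open>\<gamma> > 0\<close>, then admitting everybody is optimal
  (\<open>optimal_full_admission\<close>). The point is that each threshold \<open>y\<close> then has a negative Lagrangian
  at the level \<open>r y\<close>. Since it maximizes that Lagrangian, every control of finite revenue earns at
  most \<open>r y\<close>. So the revenue of the constant control \<open>1\<close> lies below all values of \<open>r\<close>, which makes
  that control bang-bang at the level of its own revenue.

  For strictly decreasing \<open>r\<close>, the factor \<open>r x - c\<close> vanishes at one point at most, so two
  maximizers of the same Lagrangian, one of them bang-bang, agree almost everywhere.
\<close>

section \<open>The fractional objective and its Lagrangian\<close>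

text \<open>
  The states \<open>x < 0\<close> contribute \<open>idle_revenue\<close> to the numerator and \<open>idle_mass\<close> to the denominator
  of the revenue, whatever the control.
\<close>

definition idle_revenue :: "real \<Rightarrow> (real \<Rightarrow> real) \<Rightarrow> real" where
  "idle_revenue \<gamma> r = (\<integral>x. r x * exp (- (1/2) * x\<^sup>2 - \<gamma> * x) \<partial>lebesgue_on {..0})"

definition idle_mass :: "real \<Rightarrow> real" where
  "idle_mass \<gamma> = cdf std_normal_distribution \<gamma> / std_normal_density \<gamma>"

definition mass :: "real \<Rightarrow> (real \<Rightarrow> real) \<Rightarrow> real" where
  "mass \<gamma> f = idle_mass \<gamma> + (\<integral>x. f x * exp (- \<gamma> * x) \<partial>lebesgue_on {0..})"

definition finite_revenue :: "real \<Rightarrow> (real \<Rightarrow> real) \<Rightarrow> (real \<Rightarrow> real) \<Rightarrow> bool" where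
  "finite_revenue \<gamma> r f \<longleftrightarrow> integrable (lebesgue_on {0..}) (\<lambda>x. r x * f x * exp (- \<gamma> * x))"

text \<open>
  For admissible \<open>f\<close> of finite revenue this is the numerator of the revenue minus \<open>c\<close> times its
  denominator \<open>mass \<gamma> f\<close>.
\<close>

definition lagrangian :: "real \<Rightarrow> (real \<Rightarrow> real) \<Rightarrow> real \<Rightarrow> (real \<Rightarrow> real) \<Rightarrow> real" where
  "lagrangian \<gamma> r c f =
     idle_revenue \<gamma> r - c * idle_mass \<gamma> + (\<integral>x. (r x - c) * f x * exp (- \<gamma> * x) \<partial>lebesgue_on {0..})"

text \<open>
  The values of \<open>f\<close> on the level set of \<open>c\<close> are left free: they do not contribute to the Lagrangian.
\<close>

definition bang_bang :: "(real \<Rightarrow> real) \<Rightarrow> real \<Rightarrow> (real \<Rightarrow> real) \<Rightarrow> bool" where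
  "bang_bang r c f \<longleftrightarrow> (\<forall>x\<ge>0. (c < r x \<longrightarrow> f x = 1) \<and> (r x < c \<longrightarrow> f x = 0))"

text \<open>
  The normal density is positive everywhere, so a half-line of probability zero would also be a
  null set for Lebesgue measure.
\<close>

lemma idle_mass_pos: "0 < idle_mass \<gamma>"
proof -
  interpret prob_space std_normal_distribution
    by (rule prob_space_normal_density) simp
  have "0 < cdf std_normal_distribution \<gamma>"
  proof (rule ccontr)
    assume "\<not> 0 < cdf std_normal_distribution \<gamma>"
    then have "emeasure std_normal_distribution {..\<gamma>} = 0"
      by (simp add: cdf_def emeasure_eq_measure not_less measure_le_0_iff)
    then have "{..\<gamma>} \<in> null_sets std_normal_distribution"
      by (intro null_setsI) auto
    then have "AE x in lborel. x \<in> {..\<gamma>} \<longrightarrow> ennreal (std_normal_density x) = 0"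
      by (subst (asm) null_sets_density_iff) auto
    then have "AE x in lborel. x \<notin> {..\<gamma>}"
    proof eventually_elim
      case (elim x)
      then show ?case
        using normal_density_pos[of 1 0 x] by (auto simp: ennreal_eq_0_iff)
    qed
    then have "emeasure lborel {..\<gamma>} = 0"
      by (subst (asm) AE_iff_measurable[where N = "{..\<gamma>}"]) auto
    moreover have "emeasure lborel {\<gamma> - 1..\<gamma>} \<le> emeasure lborel {..\<gamma>}"
      by (intro emeasure_mono) auto
    ultimately show False
      by simp
  qed
  then show ?thesis
    by (simp add: idle_mass_def normal_density_pos)
qed

lemma mass_pos:
  assumes "admissible_control \<gamma> f"
  shows "0 < mass \<gamma> f"
proof -
  have "0 \<le> (\<integral>x. f x * exp (- \<gamma> * x) \<partial>lebesgue_on {0..})"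
    using assms by (intro integral_nonneg_AE AE_I2) (auto simp: admissible_control_def)
  then show ?thesis
    using idle_mass_pos by (simp add: mass_def add_pos_nonneg)
qed

lemma integrable_lagrangian:
  assumes "admissible_control \<gamma> f" "finite_revenue \<gamma> r f"
  shows "integrable (lebesgue_on {0..}) (\<lambda>x. (r x - c) * f x * exp (- \<gamma> * x))"
proof -
  have "integrable (lebesgue_on {0..})
      (\<lambda>x. r x * f x * exp (- \<gamma> * x) - c * (f x * exp (- \<gamma> * x)))"
    using assms by (intro Bochner_Integration.integrable_diff integrable_mult_right)
      (auto simp: admissible_control_def finite_revenue_def)
  then show ?thesis
    by (simp add: algebra_simps)
qed

lemma revenue_eq_lagrangian:
  assumes "admissible_control \<gamma> f" "finite_revenue \<gamma> r f"
  shows "revenue \<gamma> r f = ereal (c + lagrangian \<gamma> r c f / mass \<gamma> f)"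
proof -
  let ?I = "\<lambda>h. \<integral>x. h x * exp (- \<gamma> * x) \<partial>lebesgue_on {0..}"
  have "?I (\<lambda>x. (r x - c) * f x) = ?I (\<lambda>x. r x * f x) - (\<integral>x. c * (f x * exp (- \<gamma> * x)) \<partial>lebesgue_on {0..})"
    using assms unfolding admissible_control_def finite_revenue_def
    by (subst Bochner_Integration.integral_diff[symmetric])
      (auto simp: algebra_simps intro!: Bochner_Integration.integral_cong)
  then have "idle_revenue \<gamma> r + ?I (\<lambda>x. r x * f x) = c * mass \<gamma> f + lagrangian \<gamma> r c f"
    by (simp add: lagrangian_def mass_def algebra_simps)
  moreover have "extended_integral (lebesgue_on {0..}) (\<lambda>x. r x * f x * exp (- \<gamma> * x))
      = ereal (?I (\<lambda>x. r x * f x))"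
    using assms by (intro extended_integral_eq_integral) (simp add: finite_revenue_def)
  ultimately have "revenue \<gamma> r f = ereal (c * mass \<gamma> f + lagrangian \<gamma> r c f) / ereal (mass \<gamma> f)"
    by (simp add: revenue_def idle_revenue_def mass_def idle_mass_def)
  then show ?thesis
    using mass_pos[OF assms(1)] by (simp add: field_simps)
qed

lemma revenue_compare:
  assumes "admissible_control \<gamma> f" "finite_revenue \<gamma> r f"
  shows "revenue \<gamma> r f \<le> ereal c \<longleftrightarrow> lagrangian \<gamma> r c f \<le> 0"
    and "revenue \<gamma> r f < ereal c \<longleftrightarrow> lagrangian \<gamma> r c f < 0"
    and "revenue \<gamma> r f = ereal c \<longleftrightarrow> lagrangian \<gamma> r c f = 0"
  using mass_pos[OF assms(1)]
  by (auto simp: revenue_eq_lagrangian[OF assms, of c] divide_le_0_iff divide_less_0_iff)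

text \<open>
  An upper bound on \<open>r\<close> makes the positive part of the revenue integrand integrable, so that
  integrability can fail only through an infinite negative part. Such controls never compete for
  the maximum.
\<close>

lemma revenue_eq_minus_infinity:
  assumes r: "continuous_on UNIV r" "\<And>x. 0 \<le> x \<Longrightarrow> r x \<le> b"
    and f: "admissible_control \<gamma> f" "\<not> finite_revenue \<gamma> r f"
  shows "revenue \<gamma> r f = -\<infinity>"
proof -
  let ?M = "lebesgue_on {0::real..}"
  let ?g = "\<lambda>x. r x * f x * exp (- \<gamma> * x)"
  let ?u = "\<lambda>x. \<bar>b\<bar> * (f x * exp (- \<gamma> * x))"
  have cont: "h \<in> borel_measurable ?M" if "continuous_on UNIV h" for h :: "real \<Rightarrow> real"
    using that
    by (intro measurable_restrict_space1 measurable_completion) (simp add: borel_measurable_continuous_onI)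
  have "f \<in> borel_measurable ?M"
    using f(1) by (simp add: admissible_control_def)
  then have g: "?g \<in> borel_measurable ?M"
    using r(1) by (intro borel_measurable_times cont[of r] cont[of "\<lambda>x. exp (- \<gamma> * x)"])
      (auto intro!: continuous_intros)
  have u: "integrable ?M ?u"
    using f(1) by (intro integrable_mult_right) (simp add: admissible_control_def)
  have "(\<integral>\<^sup>+ x. ennreal (?g x) \<partial>?M) \<le> (\<integral>\<^sup>+ x. ennreal (?u x) \<partial>?M)"
  proof (rule nn_integral_mono)
    fix x assume "x \<in> space ?M"
    then have x: "0 \<le> x"
      by (simp add: space_restrict_space)
    have "r x \<le> \<bar>b\<bar>"
      using r(2)[OF x] by simp
    then show "ennreal (?g x) \<le> ennreal (?u x)"
      using f(1) x unfolding admissible_control_def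
      by (intro ennreal_leI) (simp add: mult.assoc mult_right_mono)
  qed
  also have "\<dots> < \<infinity>"
    using integrableD(2)[OF u] unfolding infinity_ennreal_def less_top .
  finally have pos: "(\<integral>\<^sup>+ x. ennreal (?g x) \<partial>?M) < \<infinity>" .
  have neg: "(\<integral>\<^sup>+ x. ennreal (- ?g x) \<partial>?M) = \<infinity>"
    using f(2) g less_imp_neq[OF pos] unfolding finite_revenue_def real_integrable_def by blast
  obtain a where "0 \<le> a" "(\<integral>\<^sup>+ x. ennreal (?g x) \<partial>?M) = ennreal a"
    using pos by (cases "\<integral>\<^sup>+ x. ennreal (?g x) \<partial>?M" rule: ennreal_cases) simp_all
  then have "extended_integral ?M ?g = -\<infinity>"
    using neg by (simp add: extended_integral_def enn2ereal_ennreal)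
  then show ?thesis
    using mass_pos[OF f(1)]
    by (simp add: revenue_def mass_def idle_mass_def)
qed

section \<open>Bang-bang controls\<close>

lemma lagrangian_diff:
  assumes "admissible_control \<gamma> f" "finite_revenue \<gamma> r f"
    and "admissible_control \<gamma> g" "finite_revenue \<gamma> r g"
  shows "lagrangian \<gamma> r c f - lagrangian \<gamma> r c g
      = (\<integral>x. (r x - c) * (f x - g x) * exp (- \<gamma> * x) \<partial>lebesgue_on {0..})"
    and "integrable (lebesgue_on {0..}) (\<lambda>x. (r x - c) * (f x - g x) * exp (- \<gamma> * x))"
proof -
  note i = integrable_lagrangian[OF assms(1,2), of c] integrable_lagrangian[OF assms(3,4), of c]
  have e: "(r x - c) * (f x - g x) * exp (- \<gamma> * x)
      = (r x - c) * f x * exp (- \<gamma> * x) - (r x - c) * g x * exp (- \<gamma> * x)" for x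
    by (simp add: algebra_simps)
  show "lagrangian \<gamma> r c f - lagrangian \<gamma> r c g
      = (\<integral>x. (r x - c) * (f x - g x) * exp (- \<gamma> * x) \<partial>lebesgue_on {0..})"
    unfolding e Bochner_Integration.integral_diff[OF i] by (simp add: lagrangian_def)
  show "integrable (lebesgue_on {0..}) (\<lambda>x. (r x - c) * (f x - g x) * exp (- \<gamma> * x))"
    unfolding e using i by (rule Bochner_Integration.integrable_diff)
qed

lemma bang_bang_pointwise:
  assumes "bang_bang r c f" "admissible_control \<gamma> g" "0 \<le> x"
  shows "0 \<le> (r x - c) * (f x - g x) * exp (- \<gamma> * x)"
proof -
  have "0 \<le> g x" "g x \<le> 1"
    using assms(2,3) by (auto simp: admissible_control_def)
  then show ?thesis
    using assms(1,3) unfolding bang_bang_def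
    by (cases "r x" c rule: linorder_cases) (auto simp: mult_nonpos_nonneg mult_nonpos_nonpos)
qed

text \<open>
  By \<open>bang_bang_pointwise\<close> the bang-bang control wins at every single state, hence in the integral.
\<close>

lemma bang_bang_maximizes_lagrangian:
  assumes "bang_bang r c f"
    and "admissible_control \<gamma> f" "finite_revenue \<gamma> r f"
    and "admissible_control \<gamma> g" "finite_revenue \<gamma> r g"
  shows "lagrangian \<gamma> r c g \<le> lagrangian \<gamma> r c f"
proof -
  have "0 \<le> (\<integral>x. (r x - c) * (f x - g x) * exp (- \<gamma> * x) \<partial>lebesgue_on {0..})"
    using bang_bang_pointwise[OF assms(1,4)]
    by (intro integral_nonneg_AE AE_I2) (auto simp: space_restrict_space)
  then show ?thesis
    using lagrangian_diff(1)[OF assms(2-5), of c] by linarith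
qed

text \<open>
  Equal Lagrangians force the nonnegative integrand of \<open>bang_bang_pointwise\<close> to vanish almost
  everywhere. Injectivity of \<open>r\<close> confines the zeros of its factor \<open>r x - c\<close> to one point at most,
  so the other factor \<open>f x - g x\<close> has to vanish.
\<close>

lemma bang_bang_maximizer_AE_unique:
  assumes "bang_bang r c f"
    and "admissible_control \<gamma> f" "finite_revenue \<gamma> r f"
    and "admissible_control \<gamma> g" "finite_revenue \<gamma> r g"
    and "lagrangian \<gamma> r c g = lagrangian \<gamma> r c f"
    and "inj_on r {0..}"
  shows "AE x in lebesgue_on {0..}. g x = f x"
proof -
  let ?M = "lebesgue_on {0::real..}"
  let ?h = "\<lambda>x. (r x - c) * (f x - g x) * exp (- \<gamma> * x)"
  have nonneg: "AE x in ?M. 0 \<le> ?h x"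
    using bang_bang_pointwise[OF assms(1,4)] by (intro AE_I2) (auto simp: space_restrict_space)
  have "(\<integral>x. ?h x \<partial>?M) = 0"
    using lagrangian_diff(1)[OF assms(2-5), of c] assms(6) by simp
  then have zero: "AE x in ?M. ?h x = 0"
    using integral_nonneg_eq_0_iff_AE[OF lagrangian_diff(2)[OF assms(2-5)] nonneg] by simp
  obtain z where z: "\<And>x. 0 \<le> x \<Longrightarrow> r x = c \<Longrightarrow> x = z"
    using assms(7) by (metis atLeast_iff inj_onD)
  have "AE x in lebesgue. x \<noteq> z"
    by (intro AE_completion AE_lborel_singleton)
  then have "AE x in ?M. x \<noteq> z"
    by (subst AE_restrict_space_iff) auto
  moreover have "AE x in ?M. 0 \<le> x"
    by (intro AE_I2) (simp add: space_restrict_space)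
  ultimately show ?thesis
    using zero by eventually_elim (use z in auto)
qed

lemma optimal_control_revenue_unique:
  assumes "optimal_control \<gamma> r f" "optimal_control \<gamma> r g"
  shows "revenue \<gamma> r f = revenue \<gamma> r g"
  using assms unfolding optimal_control_def by (intro antisym) auto

text \<open>
  At the level \<open>c\<close> of its own revenue, the Lagrangian of \<open>f\<close> is zero. As \<open>f\<close> maximizes it, no other
  control has a positive Lagrangian, that is, a revenue above \<open>c\<close>. Monotonicity of \<open>r\<close> provides the
  upper bound \<open>r 0\<close> for the controls without finite revenue.
\<close>

lemma optimal_controlI:
  assumes r: "continuous_on UNIV r" "antimono_on {0..} r"
    and "bang_bang r c f" "admissible_control \<gamma> f" "finite_revenue \<gamma> r f"
    and "revenue \<gamma> r f = ereal c"
  shows "optimal_control \<gamma> r f"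
  unfolding optimal_control_def
proof (intro conjI allI impI)
  fix g assume g: "admissible_control \<gamma> g"
  show "revenue \<gamma> r g \<le> revenue \<gamma> r f"
  proof (cases "finite_revenue \<gamma> r g")
    case True
    have "lagrangian \<gamma> r c f = 0"
      using assms(6) revenue_compare(3)[OF assms(4,5)] by simp
    then have "lagrangian \<gamma> r c g \<le> 0"
      using bang_bang_maximizes_lagrangian[OF assms(3-5) g True] by simp
    then show ?thesis
      using assms(6) revenue_compare(1)[OF g True] by simp
  next
    case False
    have "r x \<le> r 0" if "0 \<le> x" for x
      using r(2) that by (auto simp: monotone_on_def)
    then have "revenue \<gamma> r g = -\<infinity>"
      using revenue_eq_minus_infinity[OF r(1) _ g False] by blast
    then show ?thesis
      by simp
  qed
qed (fact assms(4))

section \<open>Threshold controls\<close>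

lemma integrable_times_threshold:
  fixes h :: "real \<Rightarrow> real"
  assumes "continuous_on UNIV h"
  shows "integrable (lebesgue_on {0..}) (\<lambda>x. h x * threshold_control \<eta> x)"
proof -
  have "integrable (lebesgue_on {0..\<eta>}) h"
    using assms continuous_on_subset continuous_imp_integrable_real by blast
  then have "integrable lebesgue (\<lambda>x. indicator {0..\<eta>} x *\<^sub>R h x)"
    by (simp add: integrable_restrict_space)
  then have "integrable lebesgue (\<lambda>x. indicator {0..<\<eta>} x *\<^sub>R (indicator {0..\<eta>} x *\<^sub>R h x))"
    by (rule integrable_mult_indicator[rotated]) simp
  also have "(\<lambda>x. indicator {0..<\<eta>} x *\<^sub>R (indicator {0..\<eta>} x *\<^sub>R h x))
      = (\<lambda>x. indicator {0..} x *\<^sub>R (h x * threshold_control \<eta> x))"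
    by (auto simp: fun_eq_iff threshold_control_def indicator_def)
  finally show ?thesis
    by (simp add: integrable_restrict_space)
qed

lemma admissible_threshold: "admissible_control \<gamma> (threshold_control \<eta>)"
proof -
  have "integrable (lebesgue_on {0..}) (\<lambda>x. threshold_control \<eta> x)"
    using integrable_times_threshold[of "\<lambda>_. 1" \<eta>] by simp
  moreover have "integrable (lebesgue_on {0..}) (\<lambda>x. threshold_control \<eta> x * exp (- \<gamma> * x))"
    using integrable_times_threshold[of "\<lambda>x. exp (- \<gamma> * x)" \<eta>]
    by (simp add: mult.commute continuous_intros)
  ultimately show ?thesis
    unfolding admissible_control_def
    by (auto simp: threshold_control_def indicator_le_1 dest: borel_measurable_integrable)
qed

lemma finite_revenue_threshold:
  assumes "continuous_on UNIV r"
  shows "finite_revenue \<gamma> r (threshold_control \<eta>)"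
proof -
  have "continuous_on UNIV (\<lambda>x. r x * exp (- \<gamma> * x))"
    using assms by (intro continuous_intros)
  from integrable_times_threshold[OF this, of \<eta>] show ?thesis
    unfolding finite_revenue_def by (simp add: ac_simps)
qed

lemma bang_bang_threshold:
  assumes "antimono_on {0..} r" "0 \<le> \<eta>"
  shows "bang_bang r (r \<eta>) (threshold_control \<eta>)"
proof -
  have "r \<eta> \<le> r x" if "0 \<le> x" "x < \<eta>" for x
    using assms that by (auto simp: monotone_on_def)
  moreover have "r x \<le> r \<eta>" if "\<eta> \<le> x" for x
    using assms that by (auto simp: monotone_on_def)
  ultimately show ?thesis
    unfolding bang_bang_def threshold_control_def indicator_def by (simp add: not_less[symmetric]) force
qed

text \<open>
  The two cases in the definition of an optimal threshold become one: a threshold control that is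
  bang-bang at the level of its own revenue. The level is \<open>r \<eta>\<close> in the first case; in the second
  case it is the revenue of the threshold \<open>0\<close>, which dominates all values of \<open>r\<close> on the half-line.
\<close>

lemma optimal_threshold_bang_bang:
  assumes r: "continuous_on UNIV r" "antimono_on {0..} r"
    and "optimal_threshold \<gamma> r \<eta>"
  obtains c where "threshold_revenue \<gamma> r \<eta> = ereal c" "bang_bang r c (threshold_control \<eta>)"
proof (cases "ereal (r 0) > threshold_revenue \<gamma> r 0")
  case True
  then show ?thesis
    using assms(3) bang_bang_threshold[OF r(2)] by (intro that[of "r \<eta>"]) (auto simp: optimal_threshold_def)
next
  case False
  then have \<eta>: "\<eta> = 0"
    using assms(3) by (simp add: optimal_threshold_def)
  obtain c where c: "threshold_revenue \<gamma> r 0 = ereal c"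
    using threshold_revenue_eq[OF r(1), of 0 \<gamma>] by auto
  have "r x \<le> c" if "0 \<le> x" for x
  proof -
    have "r x \<le> r 0"
      using r(2) that by (auto simp: monotone_on_def)
    also have "\<dots> \<le> c"
      using False c by simp
    finally show ?thesis .
  qed
  then have "bang_bang r c (threshold_control 0)"
    by (fastforce simp: bang_bang_def threshold_control_def not_less)
  with c \<eta> show ?thesis
    by (intro that[of c]) auto
qed

lemma optimal_threshold_imp_optimal_control:
  assumes "continuous_on UNIV r" "antimono_on {0..} r" "optimal_threshold \<gamma> r \<eta>"
  shows "optimal_control \<gamma> r (threshold_control \<eta>)"
proof -
  obtain c where "threshold_revenue \<gamma> r \<eta> = ereal c" "bang_bang r c (threshold_control \<eta>)"
    using optimal_threshold_bang_bang[OF assms] .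
  then show ?thesis
    using assms(1,2) admissible_threshold finite_revenue_threshold
    by (intro optimal_controlI) (auto simp: threshold_revenue_def)
qed

lemma continuous_on_integral_upto:
  fixes h :: "real \<Rightarrow> real"
  assumes "continuous_on UNIV h"
  shows "continuous_on {0..b} (\<lambda>\<eta>. \<integral>x. h x \<partial>lebesgue_on {0..\<eta>})"
proof -
  have "(\<integral>x. h x \<partial>lebesgue_on {0..\<eta>}) = integral {0..\<eta>} h" for \<eta>
    using continuous_imp_integrable_real[OF continuous_on_subset[OF assms subset_UNIV]]
    by (intro lebesgue_integral_eq_integral) auto
  moreover have "continuous_on {0..b} (\<lambda>\<eta>. integral {0..\<eta>} h)"
    using continuous_on_subset[OF assms subset_UNIV]
    by (intro indefinite_integral_continuous_1 integrable_continuous_real)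
  ultimately show ?thesis
    by simp
qed

text \<open>
  If \<open>r 0\<close> exceeds the revenue of the threshold \<open>0\<close>, then the continuous function
  \<open>r \<eta> - R\<^sub>T \<eta>\<close> changes sign between \<open>0\<close> and \<open>x\<close>.
\<close>

lemma ex_optimal_threshold:
  assumes r: "continuous_on UNIV r"
    and x: "0 \<le> x" "ereal (r x) \<le> threshold_revenue \<gamma> r x"
  shows "\<exists>\<eta>. optimal_threshold \<gamma> r \<eta>"
proof (cases "ereal (r 0) > threshold_revenue \<gamma> r 0")
  case True
  let ?w = "\<lambda>x. exp (- \<gamma> * x)"
  define N where "N = (\<lambda>\<eta>. idle_revenue \<gamma> r + (\<integral>x. r x * ?w x \<partial>lebesgue_on {0..\<eta>}))"
  define D where "D = (\<lambda>\<eta>. idle_mass \<gamma> + (\<integral>x. ?w x \<partial>lebesgue_on {0..\<eta>}))"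
  have T: "threshold_revenue \<gamma> r \<eta> = ereal (N \<eta> / D \<eta>)" if "0 \<le> \<eta>" for \<eta>
    using threshold_revenue_eq[OF r that] by (simp add: N_def D_def idle_revenue_def idle_mass_def)
  have "0 \<le> (\<integral>x. ?w x \<partial>lebesgue_on {0..\<eta>})" for \<eta>
    by (intro integral_nonneg_AE) auto
  then have D: "0 < D \<eta>" for \<eta>
    using idle_mass_pos[of \<gamma>] by (simp add: D_def add_pos_nonneg)
  have "continuous_on {0..x} D" "continuous_on {0..x} N" "continuous_on {0..x} r"
    using r unfolding D_def N_def
    by (auto intro!: continuous_intros continuous_on_integral_upto intro: continuous_on_subset)
  then have "continuous_on {0..x} (\<lambda>\<eta>. r \<eta> - N \<eta> / D \<eta>)"
    using D by (intro continuous_intros) (auto simp: less_imp_neq[symmetric])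
  moreover have "r x - N x / D x \<le> 0" "0 \<le> r 0 - N 0 / D 0"
    using True x by (auto simp: T)
  ultimately obtain \<eta> where "0 \<le> \<eta>" "r \<eta> - N \<eta> / D \<eta> = 0"
    using IVT2'[of "\<lambda>\<eta>. r \<eta> - N \<eta> / D \<eta>" x 0 0] x(1) by auto
  then have "optimal_threshold \<gamma> r \<eta>"
    using True by (simp add: optimal_threshold_def T)
  then show ?thesis ..
next
  case False
  then have "optimal_threshold \<gamma> r 0"
    by (simp add: optimal_threshold_def)
  then show ?thesis ..
qed

section \<open>Full admission when there is no crossing\<close>

text \<open>
  The first step is that \<open>r\<close> is bounded below by the revenue \<open>a\<close> of the threshold \<open>0\<close>, which gives
  the control \<open>1\<close> finite revenue. Otherwise \<open>r\<close> takes the value \<open>a\<close> at some \<open>x\<close>; at the level \<open>a\<close>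
  the threshold \<open>0\<close> has Lagrangian zero, while the maximizing threshold \<open>x\<close> has a negative one.
  The same comparison, now between the control \<open>1\<close> and the threshold \<open>y\<close>, shows that the
  revenue of \<open>1\<close> is at most \<open>r y\<close>.
\<close>

lemma optimal_full_admission:
  assumes r: "continuous_on UNIV r" "antimono_on {0..} r"
    and "0 < \<gamma>"
    and above: "\<And>x. 0 \<le> x \<Longrightarrow> threshold_revenue \<gamma> r x < ereal (r x)"
  shows "optimal_control \<gamma> r (\<lambda>_. 1)"
proof -
  let ?M = "lebesgue_on {0::real..}"
  note T = admissible_threshold finite_revenue_threshold[OF r(1)]
  have neg: "lagrangian \<gamma> r (r x) (threshold_control x) < 0" if "0 \<le> x" for x
    using above[OF that] revenue_compare(2)[OF T] by (simp add: threshold_revenue_def)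
  obtain a where a: "threshold_revenue \<gamma> r 0 = ereal a"
    using threshold_revenue_eq[OF r(1), of 0 \<gamma>] by auto
  have lower: "a \<le> r y" if y: "0 \<le> y" for y
  proof (rule ccontr)
    assume "\<not> a \<le> r y"
    moreover have "a \<le> r 0"
      using above[of 0] a by simp
    moreover have "continuous_on {0..y} r"
      using r(1) continuous_on_subset by blast
    ultimately obtain x where x: "0 \<le> x" "r x = a"
      using IVT2'[of r y a 0] y by auto
    have "lagrangian \<gamma> r (r x) (threshold_control 0) = 0"
      using a x(2) revenue_compare(3)[OF T] by (simp add: threshold_revenue_def)
    then show False
      using bang_bang_maximizes_lagrangian[OF bang_bang_threshold[OF r(2) x(1)] T T, of \<gamma> 0] neg[OF x(1)]
      by simp
  qed
  have upper: "r y \<le> r 0" if "0 \<le> y" for y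
    using r(2) that by (auto simp: monotone_on_def)
  have w: "integrable ?M (\<lambda>x. exp (- \<gamma> * x))"
  proof -
    have "(\<lambda>x. exp (- \<gamma> * x)) absolutely_integrable_on {0..}"
      using integrable_on_exp_minus_to_infinity[OF \<open>0 < \<gamma>\<close>, of 0]
      by (intro nonnegative_absolutely_integrable_1) (auto simp: mult.commute)
    then show ?thesis
      by (simp add: absolutely_integrable_on_def set_integrable_def integrable_restrict_space)
  qed
  have one: "admissible_control \<gamma> (\<lambda>_. 1)"
    using w by (simp add: admissible_control_def)
  have fin: "finite_revenue \<gamma> r (\<lambda>_. 1)"
    unfolding finite_revenue_def
  proof (rule Bochner_Integration.integrable_bound)
    show "integrable ?M (\<lambda>x. (\<bar>a\<bar> + \<bar>r 0\<bar>) * exp (- \<gamma> * x))"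
      using w by (rule integrable_mult_right)
    have "continuous_on UNIV (\<lambda>x. r x * 1 * exp (- \<gamma> * x))"
      using r(1) by (intro continuous_intros)
    then show "(\<lambda>x. r x * 1 * exp (- \<gamma> * x)) \<in> borel_measurable ?M"
      by (intro measurable_restrict_space1 measurable_completion)
        (simp add: borel_measurable_continuous_onI)
    have "\<bar>r x\<bar> \<le> \<bar>a\<bar> + \<bar>r 0\<bar>" if "0 \<le> x" for x
      using lower[OF that] upper[OF that] by linarith
    then show "AE x in ?M. norm (r x * 1 * exp (- \<gamma> * x)) \<le> norm ((\<bar>a\<bar> + \<bar>r 0\<bar>) * exp (- \<gamma> * x))"
      by (intro AE_I2) (simp add: abs_mult space_restrict_space mult_right_mono)
  qed
  obtain c where c: "revenue \<gamma> r (\<lambda>_. 1) = ereal c"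
    using revenue_eq_lagrangian[OF one fin] by blast
  have "c \<le> r y" if "0 \<le> y" for y
  proof -
    have "lagrangian \<gamma> r (r y) (\<lambda>_. 1) \<le> 0"
      using bang_bang_maximizes_lagrangian[OF bang_bang_threshold[OF r(2) that] T one fin] neg[OF that]
      by simp
    then show ?thesis
      using c revenue_compare(1)[OF one fin] by simp
  qed
  then have "bang_bang r c (\<lambda>_. 1)"
    by (fastforce simp: bang_bang_def not_less)
  then show ?thesis
    using optimal_controlI[OF r] one fin c by blast
qed

section \<open>Uniqueness\<close>

text \<open>
  An optimal control has the same revenue as the threshold control. This revenue is a real number
  \<open>c\<close>, so the control has finite revenue, and at the level \<open>c\<close> both Lagrangians are zero.
\<close>

lemma optimal_control_AE_unique:
  assumes r: "continuous_on UNIV r" "antimono_on {0..} r" "inj_on r {0..}"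
    and \<eta>: "optimal_threshold \<gamma> r \<eta>" and f: "optimal_control \<gamma> r f"
  shows "AE x in lebesgue_on {0..}. f x = threshold_control \<eta> x"
proof -
  note T = admissible_threshold finite_revenue_threshold[OF r(1)]
  obtain c where c: "threshold_revenue \<gamma> r \<eta> = ereal c" "bang_bang r c (threshold_control \<eta>)"
    using optimal_threshold_bang_bang[OF r(1,2) \<eta>] .
  have fa: "admissible_control \<gamma> f"
    using f by (simp add: optimal_control_def)
  have fc: "revenue \<gamma> r f = ereal c"
    using optimal_control_revenue_unique[OF f optimal_threshold_imp_optimal_control[OF r(1,2) \<eta>]] c(1)
    by (simp add: threshold_revenue_def)
  have "r x \<le> r 0" if "0 \<le> x" for x
    using r(2) that by (auto simp: monotone_on_def)
  then have fin: "finite_revenue \<gamma> r f"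
    using revenue_eq_minus_infinity[OF r(1) _ fa] fc by force
  have "lagrangian \<gamma> r c f = lagrangian \<gamma> r c (threshold_control \<eta>)"
    using fc c(1) revenue_compare(3)[OF fa fin] revenue_compare(3)[OF T]
    by (simp add: threshold_revenue_def)
  then show ?thesis
    using bang_bang_maximizer_AE_unique[OF c(2) T fa fin _ r(3)] by blast
qed

text \<open>
  In the case of the equation, the value of \<open>r\<close> at an optimal threshold is the optimal revenue,
  which is the same for both thresholds.
\<close>

lemma optimal_threshold_unique:
  assumes r: "continuous_on UNIV r" "antimono_on {0..} r" "inj_on r {0..}"
    and \<eta>: "optimal_threshold \<gamma> r \<eta>" "optimal_threshold \<gamma> r \<eta>'"
  shows "\<eta> = \<eta>'"
proof (cases "ereal (r 0) > threshold_revenue \<gamma> r 0")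
  case True
  have "threshold_revenue \<gamma> r \<eta> = threshold_revenue \<gamma> r \<eta>'"
    unfolding threshold_revenue_def
    using \<eta>[THEN optimal_threshold_imp_optimal_control[OF r(1,2)]]
    by (rule optimal_control_revenue_unique)
  moreover have "ereal (r \<eta>) = threshold_revenue \<gamma> r \<eta>" "ereal (r \<eta>') = threshold_revenue \<gamma> r \<eta>'"
    using \<eta> True by (auto simp: optimal_threshold_def)
  ultimately have "r \<eta> = r \<eta>'"
    by (metis ereal.inject)
  then show ?thesis
    using r(3) \<eta> by (auto simp: optimal_threshold_def dest: inj_onD)
next
  case False
  then show ?thesis
    using \<eta> by (simp add: optimal_threshold_def)
qed

theorem proposition2:
  fixes \<gamma> :: real and r :: "real \<Rightarrow> real"
  assumes "revenue_profile r"
    and "antimono_on {0..} r"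
  shows
    "(\<gamma> > 0 \<or> (\<exists>x\<ge>0. ereal (r x) \<le> threshold_revenue \<gamma> r x) \<longrightarrow>
        (\<exists>f. optimal_control \<gamma> r f)) \<and>
     ((\<exists>x\<ge>0. ereal (r x) \<le> threshold_revenue \<gamma> r x) \<longrightarrow>
        (\<exists>\<eta>. optimal_threshold \<gamma> r \<eta>)) \<and>
     (\<forall>\<eta>. optimal_threshold \<gamma> r \<eta> \<longrightarrow> optimal_control \<gamma> r (threshold_control \<eta>)) \<and>
     (strict_antimono_on {0..} r \<longrightarrow>
        (\<forall>\<eta> \<eta>'. optimal_threshold \<gamma> r \<eta> \<and> optimal_threshold \<gamma> r \<eta>' \<longrightarrow> \<eta> = \<eta>') \<and>
        (\<forall>\<eta> f. optimal_threshold \<gamma> r \<eta> \<and> optimal_control \<gamma> r f \<longrightarrow>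
           (AE x in lebesgue_on {0..}. f x = threshold_control \<eta> x)))"
proof -
  have cont: "continuous_on UNIV r"
    using assms(1) by (simp add: revenue_profile_def)
  note r = cont assms(2)
  have crossing: "\<exists>\<eta>. optimal_threshold \<gamma> r \<eta>" if "\<exists>x\<ge>0. ereal (r x) \<le> threshold_revenue \<gamma> r x"
    using that ex_optimal_threshold[OF cont] by blast
  have "\<exists>f. optimal_control \<gamma> r f" if "\<gamma> > 0 \<or> (\<exists>x\<ge>0. ereal (r x) \<le> threshold_revenue \<gamma> r x)"
  proof (cases "\<exists>x\<ge>0. ereal (r x) \<le> threshold_revenue \<gamma> r x")
    case True
    then show ?thesis
      using crossing optimal_threshold_imp_optimal_control[OF r] by blast
  next
    case False
    then have "threshold_revenue \<gamma> r x < ereal (r x)" if "0 \<le> x" for x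
      unfolding not_le[symmetric] using False \<open>0 \<le> x\<close> by blast
    moreover have "0 < \<gamma>"
      using that False by blast
    ultimately show ?thesis
      using optimal_full_admission[OF r] by blast
  qed
  moreover have "inj_on r {0..}" if "strict_antimono_on {0..} r"
  proof (rule linorder_inj_onI)
    show "r x \<noteq> r y" if "x < y" "x \<in> {0..}" "y \<in> {0..}" for x y
      using monotone_onD[OF \<open>strict_antimono_on {0..} r\<close>, of x y] that by auto
  qed auto
  ultimately show ?thesis
    using crossing optimal_threshold_imp_optimal_control[OF r]
      optimal_threshold_unique[OF r] optimal_control_AE_unique[OF r] by blast
qed

end
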